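(* Let $c$ be a positive integer constant. In the local beeping model, the time of rendezvous on the two-node graph of $c$-bounded agents with labels from the set $\{1,\dots,M\}$ is $\Omega(\sqrt[c]{M})$. That is, there is a constant $\kappa>0$ depending only on $c$ such that for every integer $M\ge2$ and every deterministic algorithm by which any two $c$-bounded agents with distinct labels from $\{1,\dots,M\}$ achieve rendezvous on the two-node graph, the worst-case time of the algorithm is at least $\kappa\sqrt[c]{M}$.
   Context: The two-node graph consists of two unlabeled nodes joined by one edge, which has port number $0$ at each endpoint. **Agents.** Two agents executing the same deterministic algorithm have distinct labels; each agent knows its own label but not the other's. An adversary chooses the starting nodes and the (possibly different) activation rounds; each agent appears at its starting node when activated. Time proceeds in synchronous rounds. In each round an agent stays at its node or moves to the neighbor; its node in that round is the one reached after this action. In each round an agent also either beeps or listens. An agent's decision in a round depends only on its label and its own history since activation (degrees of visited nodes, ports of entry, beeps heard). A $c$-bounded agent is an agent that can perform at most $c$ moves (edge traversals) in total. **Local beeping model.** An agent hears a beep in a round iff it listens in this round, the other agent (already activated) is at the same node in this round, and the other agent beeps in this round. **Rendezvous** (no detection required) is achieved in the first round in which both agents are at the same node. The time of an execution is the number of rounds from the activation of the later agent to rendezvous. The time of an algorithm is the worst case over all pairs of distinct labels from $\{1,\dots,M\}$, all initial positions and all activation rounds. *)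

theory Defs
  imports Complex_Main "HOL-Library.Extended_Real"
begin

datatype node = Node0 | Node1

fun neighbour :: "node \<Rightarrow> node" where
  "neighbour Node0 = Node1"
| "neighbour Node1 = Node0"

definition degree :: "node \<Rightarrow> nat" where
  "degree v = 1"

text \<open>
  What an agent perceives in a round: the degree of its node, the port by which it entered that
  node in this round (\<open>None\<close> if it stayed), and whether it heard a beep. On activation it
  additionally perceives its starting node, with no port of entry and no beep.
\<close>

datatype percept = Percept (deg: nat) (entry: "nat option") (heard: bool)

definition initial_percept :: "node \<Rightarrow> percept" where
  "initial_percept v = Percept (degree v) None False"

text \<open>
  The only possible move is through port 0. An agent that does not beep listens.
\<close>

datatype action = Action (moves: bool) (beeps: bool)

text \<open>
  A decision depends on the label and on the percepts since activation, oldest first. The agent's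
  own past actions are determined by these, and so need not be recorded.
\<close>

type_synonym algorithm = "nat \<Rightarrow> percept list \<Rightarrow> action"

datatype agent = Agent1 | Agent2

fun other :: "agent \<Rightarrow> agent" where
  "other Agent1 = Agent2"
| "other Agent2 = Agent1"

record scenario =
  label :: "agent \<Rightarrow> nat"
  start :: "agent \<Rightarrow> node"
  activation :: "agent \<Rightarrow> nat"

definition dest :: "action \<Rightarrow> node \<Rightarrow> node" where
  "dest x v = (if moves x then neighbour v else v)"

text \<open>
  \<open>hears\<close> is the local beeping rule, where \<open>x\<close> and \<open>v\<close> give the action of each agent in round \<open>t\<close>
  and its node in that round, that is, after the possible move.
\<close>

definition hears ::
  "scenario \<Rightarrow> nat \<Rightarrow> (agent \<Rightarrow> action) \<Rightarrow> (agent \<Rightarrow> node) \<Rightarrow> agent \<Rightarrow> bool" where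
  "hears S t x v a \<longleftrightarrow>
     \<not> beeps (x a) \<and> activation S (other a) \<le> t \<and> v (other a) = v a \<and> beeps (x (other a))"

text \<open>
  \<open>exec A S t a\<close> is the node and the history of agent \<open>a\<close> just before round \<open>t\<close>; rounds are
  numbered from 0. An agent acts for the first time in the round of its activation. Before that it
  is not present in the graph, and the node component is only its future starting node.
\<close>

primrec exec :: "algorithm \<Rightarrow> scenario \<Rightarrow> nat \<Rightarrow> agent \<Rightarrow> node \<times> percept list" where
  "exec A S 0 = (\<lambda>a. (start S a, [initial_percept (start S a)]))"
| "exec A S (Suc t) =
     (let x = (\<lambda>a. A (label S a) (snd (exec A S t a)));
          v = (\<lambda>a. dest (x a) (fst (exec A S t a)))
      in (\<lambda>a. if t < activation S a then exec A S t a
              else (v a, snd (exec A S t a) @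
                     [Percept (degree (v a)) (if moves (x a) then Some 0 else None)
                        (hears S t x v a)])))"

definition node_in :: "algorithm \<Rightarrow> scenario \<Rightarrow> nat \<Rightarrow> agent \<Rightarrow> node" where
  "node_in A S t a = fst (exec A S (Suc t) a)"

definition move_rounds :: "algorithm \<Rightarrow> scenario \<Rightarrow> agent \<Rightarrow> nat set" where
  "move_rounds A S a =
     {t. activation S a \<le> t \<and> moves (A (label S a) (snd (exec A S t a)))}"

definition together :: "algorithm \<Rightarrow> scenario \<Rightarrow> nat \<Rightarrow> bool" where
  "together A S t \<longleftrightarrow> activation S Agent1 \<le> t \<and> activation S Agent2 \<le> t \<and>
     node_in A S t Agent1 = node_in A S t Agent2"

definition exec_time :: "algorithm \<Rightarrow> scenario \<Rightarrow> enat" where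
  "exec_time A S =
     (if \<exists>t. together A S t
      then enat ((LEAST t. together A S t) - max (activation S Agent1) (activation S Agent2))
      else \<infinity>)"

text \<open>
  The starting nodes (equal or not) and the activation rounds are unrestricted.
\<close>

definition scenarios :: "nat \<Rightarrow> scenario set" where
  "scenarios M = {S. label S Agent1 \<in> {1..M} \<and> label S Agent2 \<in> {1..M} \<and>
                     label S Agent1 \<noteq> label S Agent2}"

text \<open>
  All moves of an execution count, including those after rendezvous.
\<close>

definition bounded_agents :: "nat \<Rightarrow> nat \<Rightarrow> algorithm \<Rightarrow> bool" where
  "bounded_agents c M A \<longleftrightarrow>
     (\<forall>S\<in>scenarios M. \<forall>a. finite (move_rounds A S a) \<and> card (move_rounds A S a) \<le> c)"

definition achieves_rendezvous :: "nat \<Rightarrow> algorithm \<Rightarrow> bool" where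
  "achieves_rendezvous M A \<longleftrightarrow> (\<forall>S\<in>scenarios M. \<exists>t. together A S t)"

definition worst_time :: "nat \<Rightarrow> algorithm \<Rightarrow> enat" where
  "worst_time M A = (SUP S\<in>scenarios M. exec_time A S)"

end

theory Submission imports Defs begin

text \<open>
  Agents at different nodes never hear each other, so before rendezvous each agent moves as if it
  were alone. If two labels prescribe the same solo moves in rounds \<open>0..T\<close>, agents with these labels
  that are activated together at different nodes stay apart during these rounds. Hence an
  algorithm of time \<open>T\<close> yields an injection of the labels into the subsets of \<open>{0..T}\<close> with at most
  \<open>c\<close> elements, and \<open>M \<le> (T + 2) ^ c\<close>. Moreover \<open>T \<ge> 1\<close>, since the adversary can choose the starting
  nodes so that the agents are apart after their first actions; so \<open>T + 2 \<le> 3 * T\<close>.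
\<close>

text \<open>The starting node is absent from the arguments: both nodes have degree 1 and entry port
  0, so an agent that hears nothing cannot tell them apart.\<close>

primrec solo :: "algorithm \<Rightarrow> nat \<Rightarrow> nat \<Rightarrow> percept list" where
  "solo A l 0 = [Percept 1 None False]"
| "solo A l (Suc t) =
     solo A l t @ [Percept 1 (if moves (A l (solo A l t)) then Some 0 else None) False]"

definition solo_moves :: "algorithm \<Rightarrow> nat \<Rightarrow> nat \<Rightarrow> nat set" where
  "solo_moves A l n = {t. t < n \<and> moves (A l (solo A l t))}"

text \<open>An agent not yet activated cannot be heard, wherever the two agents start. This
  transfers the move bound from two-agent executions to solo histories.\<close>

lemma history_before_other_activated:
  assumes "activation S a = 0" "t \<le> activation S (other a)"
  shows "snd (exec A S t a) = solo A (label S a) t"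
  using assms(2)
  by (induction t) (simp_all add: assms(1) initial_percept_def degree_def hears_def Let_def)

lemma neighbour_eq_iff [simp]: "neighbour u = neighbour v \<longleftrightarrow> u = v"
  by (cases u; cases v) simp_all

lemma apart_while_solo_moves_agree:
  assumes act: "\<And>a. activation S a = 0"
    and start: "start S Agent1 \<noteq> start S Agent2"
    and agree: "solo_moves A (label S Agent1) n = solo_moves A (label S Agent2) n"
    and "t \<le> n"
  shows "(\<forall>a. snd (exec A S t a) = solo A (label S a) t) \<and>
    fst (exec A S t Agent1) \<noteq> fst (exec A S t Agent2)"
  using \<open>t \<le> n\<close>
proof (induction t)
  case 0
  show ?case by (simp add: start initial_percept_def degree_def)
next
  case (Suc t)
  then have hist: "snd (exec A S t a) = solo A (label S a) t" for a
    by simp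
  from Suc have apart: "fst (exec A S t Agent1) \<noteq> fst (exec A S t Agent2)"
    by simp
  have "t \<in> solo_moves A (label S Agent1) n \<longleftrightarrow> t \<in> solo_moves A (label S Agent2) n"
    by (simp add: agree)
  with Suc.prems have same: "moves (A (label S Agent1) (solo A (label S Agent1) t)) \<longleftrightarrow>
      moves (A (label S Agent2) (solo A (label S Agent2) t))"
    by (simp add: solo_moves_def)
  \<comment> \<open>Either both agents stay or both cross the edge, and \<open>neighbour\<close> is
    injective.\<close>
  have apart': "fst (exec A S (Suc t) Agent1) \<noteq> fst (exec A S (Suc t) Agent2)"
    using apart same by (simp add: Let_def act hist dest_def)
  have "snd (exec A S (Suc t) a) = solo A (label S a) (Suc t)" for a
  proof -
    \<comment> \<open>Hearing depends on the nodes after the move, so apartness after round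
      \<open>t\<close> is what makes the new percept silent.\<close>
    have "dest (A (label S a) (solo A (label S a) t)) (fst (exec A S t a)) \<noteq>
        dest (A (label S (other a)) (solo A (label S (other a)) t)) (fst (exec A S t (other a)))"
      using apart' by (cases a) (simp_all add: Let_def act hist eq_commute)
    then show ?thesis
      by (simp add: Let_def act hist hears_def degree_def)
  qed
  with apart' show ?case by blast
qed

lemma card_solo_moves_le:
  assumes "bounded_agents c M A" "M \<ge> 2" "l \<in> {1..M}"
  shows "card (solo_moves A l n) \<le> c"
proof -
  obtain l' where l': "l' \<in> {1..M}" "l' \<noteq> l"
    using assms(2) by (cases "l = 1") (auto intro: that[of 1] that[of 2])
  \<comment> \<open>The partner wakes only in round \<open>n\<close>, so \<open>Agent1\<close> acts
    alone in all rounds below \<open>n\<close>.\<close>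
  define S where "S = \<lparr>label = case_agent l l', start = (\<lambda>_. Node0), activation = case_agent 0 n\<rparr>"
  have "S \<in> scenarios M"
    using assms(3) l' by (auto simp: S_def scenarios_def)
  with assms(1) have bound: "finite (move_rounds A S Agent1)" "card (move_rounds A S Agent1) \<le> c"
    by (auto simp: bounded_agents_def)
  have "solo_moves A l n \<subseteq> move_rounds A S Agent1"
  proof
    fix t assume "t \<in> solo_moves A l n"
    moreover from this have "snd (exec A S t Agent1) = solo A l t"
      using history_before_other_activated[of S Agent1 t A] by (simp add: S_def solo_moves_def)
    ultimately show "t \<in> move_rounds A S Agent1"
      by (simp add: S_def solo_moves_def move_rounds_def)
  qed
  with bound show ?thesis
    by (meson card_mono order_trans)
qed

lemma together_within_worst_time:
  assumes "worst_time M A = enat T" "S \<in> scenarios M" "\<And>a. activation S a = 0"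
  obtains t where "t \<le> T" "together A S t"
proof -
  have le: "exec_time A S \<le> enat T"
    using assms(1,2) by (metis SUP_upper worst_time_def)
  \<comment> \<open>Without rendezvous the execution time would be \<infinity>, exceeding
    \<open>T\<close>.\<close>
  then have ex: "\<exists>t. together A S t"
    by (auto simp: exec_time_def split: if_splits)
  with le have "(LEAST t. together A S t) \<le> T"
    by (simp add: exec_time_def assms(3))
  with LeastI_ex[OF ex] show thesis
    using that by blast
qed

lemma inj_on_solo_moves:
  assumes "worst_time M A = enat T"
  shows "inj_on (\<lambda>l. solo_moves A l (Suc T)) {1..M}"
proof (rule inj_onI, rule ccontr)
  fix l l' assume l: "l \<in> {1..M}" "l' \<in> {1..M}" "l \<noteq> l'"
    and agree: "solo_moves A l (Suc T) = solo_moves A l' (Suc T)"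
  define S where
    "S = \<lparr>label = case_agent l l', start = case_agent Node0 Node1, activation = (\<lambda>_. 0)\<rparr>"
  have "S \<in> scenarios M"
    using l by (auto simp: S_def scenarios_def)
  from together_within_worst_time[OF assms this]
  obtain t where t: "t \<le> T" "together A S t"
    by (auto simp: S_def)
  \<comment> \<open>The nodes in round \<open>t\<close> are the state at \<open>Suc t\<close>; hence
    solo moves are compared below \<open>Suc T\<close>.\<close>
  have "fst (exec A S (Suc t) Agent1) \<noteq> fst (exec A S (Suc t) Agent2)"
    using apart_while_solo_moves_agree[of S A "Suc T" "Suc t"] agree t(1)
    by (simp add: S_def del: exec.simps)
  with t(2) show False
    by (simp add: together_def node_in_def del: exec.simps)
qed

lemma worst_time_pos:
  assumes "worst_time M A = enat T" "M \<ge> 2"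
  shows "T \<ge> 1"
proof (rule ccontr)
  assume "\<not> T \<ge> 1"
  then have "T = 0"
    by simp
  define m where "m = (\<lambda>l. moves (A l (solo A l 0)))"
  \<comment> \<open>Equal first choices preserve different starting nodes; if exactly one agent
    moves, a common starting node separates them.\<close>
  define S where "S = \<lparr>label = case_agent 1 2,
    start = case_agent Node0 (if m 1 = m 2 then Node1 else Node0), activation = (\<lambda>_. 0)\<rparr>"
  have "S \<in> scenarios M"
    using assms(2) by (auto simp: S_def scenarios_def)
  from together_within_worst_time[OF assms(1) this]
  obtain t where "t \<le> T" "together A S t"
    by (auto simp: S_def)
  with \<open>T = 0\<close> have "together A S 0"
    by simp
  then have "dest (A 1 (solo A 1 0)) (start S Agent1) = dest (A 2 (solo A 2 0)) (start S Agent2)"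
    by (simp add: S_def together_def node_in_def Let_def initial_percept_def degree_def)
  then show False
    by (cases "m 1"; cases "m 2") (simp_all add: S_def m_def dest_def del: solo.simps)
qed

text \<open>
  Each small subset is padded with the dummy element \<open>n\<close> to a list of length exactly \<open>c\<close>.
\<close>

lemma card_small_subsets_le:
  fixes n c :: nat
  shows "card {X. X \<subseteq> {..<n} \<and> card X \<le> c} \<le> (n + 1) ^ c"
proof -
  let ?L = "{xs. set xs \<subseteq> {..n} \<and> length xs = c}"
  have "{X. X \<subseteq> {..<n} \<and> card X \<le> c} \<subseteq> (\<lambda>xs. set xs - {n}) ` ?L"
  proof clarify
    fix X assume X: "X \<subseteq> {..<n}" "card X \<le> c"
    then have "finite X"
      using finite_subset by blast
    define xs where "xs = sorted_list_of_set X @ replicate (c - card X) n"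
    have "xs \<in> ?L"
      using X \<open>finite X\<close> by (auto simp: xs_def)
    moreover have "X = set xs - {n}"
      using X \<open>finite X\<close> by (auto simp: xs_def)
    ultimately show "X \<in> (\<lambda>xs. set xs - {n}) ` ?L"
      by blast
  qed
  then have "card {X. X \<subseteq> {..<n} \<and> card X \<le> c} \<le> card ?L"
    by (rule surj_card_le[rotated]) (simp add: finite_lists_length_eq)
  then show ?thesis
    by (simp add: card_lists_length_eq)
qed

lemma labels_le_power:
  assumes "worst_time M A = enat T" "bounded_agents c M A" "M \<ge> 2"
  shows "M \<le> (T + 2) ^ c"
proof -
  let ?X = "{X. X \<subseteq> {..<Suc T} \<and> card X \<le> c}"
  have "(\<lambda>l. solo_moves A l (Suc T)) ` {1..M} \<subseteq> ?X"
    using card_solo_moves_le[OF assms(2,3)] by (auto simp: solo_moves_def)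
  then have "card {1..M} \<le> card ?X"
    by (intro card_inj_on_le[OF inj_on_solo_moves[OF assms(1)]]) auto
  with card_small_subsets_le[of "Suc T" c] show ?thesis
    by simp
qed

theorem theorem4p2:
  fixes c :: nat
  assumes "c \<ge> 1"
  shows "\<exists>\<kappa>::real. \<kappa> > 0 \<and>
    (\<forall>(M::nat) (A::algorithm). M \<ge> 2 \<longrightarrow> bounded_agents c M A \<longrightarrow> achieves_rendezvous M A \<longrightarrow>
       ereal (\<kappa> * root c (real M)) \<le> ereal_of_enat (worst_time M A))"
proof (intro exI[of _ "1/3"] conjI allI impI)
  fix M A assume M: "M \<ge> 2" "bounded_agents c M A"
  show "ereal (1/3 * root c (real M)) \<le> ereal_of_enat (worst_time M A)"
  \<comment> \<open>An infinite worst-case time satisfies the bound trivially.\<close>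
  proof (cases "worst_time M A")
    case (enat T)
    have "real M \<le> (real T + 2) ^ c"
      using labels_le_power[OF enat M(2,1)]
      by (metis of_nat_add of_nat_le_iff of_nat_numeral of_nat_power)
    then have "root c (real M) \<le> root c ((real T + 2) ^ c)"
      using assms by simp
    also have "\<dots> = real T + 2"
      using assms by (intro real_root_power_cancel) auto
    also have "\<dots> \<le> 3 * real T"
      using worst_time_pos[OF enat M(1)] by simp
    finally show ?thesis
      by (simp add: enat)
  qed simp
qed simp

end
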